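(* Let $r\ge1$, let $p_1,\dots,p_r\ge5$ be distinct primes, $P=p_1\cdots p_r$ and $M=6P$. With the notation of the context, for every positive integer $n$, $$g_P(2n)=\frac nM\kappa_P(n)+\mathcal E_P(n),$$ where $$\mathcal E_P(n)=\begin{cases}\mathcal B_P(n), & \delta_3(n)=0,\\[4pt] \dfrac{\mathcal B_P(n)+D_P(n)}2+\dfrac{A_P(n)}{3P}, & \delta_3(n)=1,\\[8pt] \dfrac{\mathcal B_P(n)+D_P(n)}2-\dfrac{A_P(n)}{3P}, & \delta_3(n)=2.\end{cases}$$ In particular, $|\mathcal E_P(n)|<3^r-1$.
   Context: $\mathbf 1_{\{\cdot\}}$ denotes an indicator. For $q\in\mathbb Z_{>0}$ and $x\in\mathbb Z$, $\delta_q(x)=x-q\lfloor x/q\rfloor\in\{0,\dots,q-1\}$. $g_P(2n)$ is the number of pairs $(h,k)\in\mathbb Z_{>0}^2$ with $h+k=2n$, $h\le k$, $\gcd(h,M)=\gcd(k,M)=1$. $\varepsilon_i(n)=\mathbf 1_{\{\delta_{p_i}(n)=0\}}$, $A_P(n)=\prod_{i=1}^r(p_i-2+\varepsilon_i(n))$, $\kappa_P(n)=(1+\mathbf 1_{\{\delta_3(n)=0\}})A_P(n)$, $D_P(n)=\mathbf 1_{\{\gcd(n,6P)=1\}}$. For a prime $p\ge5$: $a(p)=\frac{p\,\delta_6(p)-1}{6}$ and $b(p)=p-1-a(p)$ (both integers in $\{0,\dots,p-1\}$). Write $a_i=a(p_i)$, $b_i=b(p_i)$. $m(n)=\frac n3-1$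 if $\delta_3(n)=0$; $m(n)=\frac{n-1}{3}$ if $\delta_3(n)=1$; $m(n)=\frac{n-5}{3}$ if $\delta_3(n)=2$. For $1\le i\le r$ define $x_i(n),y_i(n)\in\{0,\dots,p_i-1\}$: if $\delta_3(n)=0$, $x_i(n)=a_i$, $y_i(n)=\delta_{p_i}(m(n)-b_i)$; if $\delta_3(n)=1$, $x_i(n)=a_i$, $y_i(n)=\delta_{p_i}(m(n)-a_i)$; if $\delta_3(n)=2$, $x_i(n)=b_i$, $y_i(n)=\delta_{p_i}(m(n)-b_i)$. Weights: $w_{i,0}(n)=1$, $w_{i,1}(n)=-(1-\varepsilon_i(n))$, $w_{i,2}(n)=-1$. For $\boldsymbol\alpha\in\{0,1,2\}^r$: $W_{\boldsymbol\alpha}(n)=\prod_{i=1}^r w_{i,\alpha_i}(n)$, $I_{\boldsymbol\alpha}=\{i:\alpha_i\ne0\}$, $Q_{\boldsymbol\alpha}=\prod_{i\in I_{\boldsymbol\alpha}}p_i$ (empty product $=1$). Put $s_{i,1}(n)=x_i(n)$, $s_{i,2}(n)=y_i(n)$. If $I_{\boldsymbol\alpha}=\varnothing$, $\eta_{\boldsymbol\alpha}(n)=0$; otherwise $\eta_{\boldsymbol\alpha}(n)$ is the unique element of $\{0,\dots,Q_{\boldsymbol\alpha}-1\}$ with $\delta_{p_i}(\eta_{\boldsymbol\alpha}(n))=s_{i,\alpha_i}(n)$ for all $i\in I_{\boldsymbol\alpha}$. For integers $m\ge-1$, $q\ge1$, $0\le a\le q-1$: $L(m,q,a)=\#\{z\in\mathbb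 Z:0\le z\le m,\ \delta_q(z)=a\}$, which equals $1+\left\lfloor\frac{m-a}{q}\right\rfloor$. $$\mathcal B_P(n)=\sum_{\boldsymbol\alpha\neq\boldsymbol0}W_{\boldsymbol\alpha}(n)\left[L\bigl(m(n),Q_{\boldsymbol\alpha},\eta_{\boldsymbol\alpha}(n)\bigr)-\frac{m(n)+1}{Q_{\boldsymbol\alpha}}\right],$$ the sum being over nonzero $\boldsymbol\alpha\in\{0,1,2\}^r$. *)

theory Defs
  imports Complex_Main "HOL-Library.FuncSet" "HOL-Computational_Algebra.Primes"
begin

text \<open>
  The distinct primes are \<open>p 1, \<dots>, p r\<close>, given as integers by a function \<open>p\<close> that is only
  inspected on \<open>{1..r}\<close>. For \<open>q > 0\<close>, \<open>\<delta>\<^sub>q(x) = x - q\<lfloor>x/q\<rfloor>\<close> is \<open>x mod q\<close> on \<^typ>\<open>int\<close>,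
  also for negative \<open>x\<close>.
\<close>

definition delta :: "int \<Rightarrow> int \<Rightarrow> int" where
  "delta q x = x mod q"

definition P_prod :: "nat \<Rightarrow> (nat \<Rightarrow> int) \<Rightarrow> int" where
  "P_prod r p = (\<Prod>i\<in>{1..r}. p i)"

definition M_mod :: "nat \<Rightarrow> (nat \<Rightarrow> int) \<Rightarrow> int" where
  "M_mod r p = 6 * P_prod r p"

definition g_P :: "nat \<Rightarrow> (nat \<Rightarrow> int) \<Rightarrow> int \<Rightarrow> nat" where
  "g_P r p N = card {(h, k). h > 0 \<and> k > 0 \<and> h + k = N \<and> h \<le> k \<and>
                        gcd h (M_mod r p) = 1 \<and> gcd k (M_mod r p) = 1}"

definition eps :: "(nat \<Rightarrow> int) \<Rightarrow> nat \<Rightarrow> int \<Rightarrow> int" where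
  "eps p i n = of_bool (delta (p i) n = 0)"

definition A_P :: "nat \<Rightarrow> (nat \<Rightarrow> int) \<Rightarrow> int \<Rightarrow> int" where
  "A_P r p n = (\<Prod>i\<in>{1..r}. (p i - 2 + eps p i n))"

definition kappa_P :: "nat \<Rightarrow> (nat \<Rightarrow> int) \<Rightarrow> int \<Rightarrow> int" where
  "kappa_P r p n = (1 + of_bool (delta 3 n = 0)) * A_P r p n"

definition D_P :: "nat \<Rightarrow> (nat \<Rightarrow> int) \<Rightarrow> int \<Rightarrow> int" where
  "D_P r p n = of_bool (gcd n (6 * P_prod r p) = 1)"

text \<open>
  Integer division in \<open>a_coef\<close> is exact for \<open>q\<close> coprime to 6, and in \<open>m_of\<close> it is always exact.
\<close>

definition a_coef :: "int \<Rightarrow> int" where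
  "a_coef q = (q * delta 6 q - 1) div 6"

definition b_coef :: "int \<Rightarrow> int" where
  "b_coef q = q - 1 - a_coef q"

definition m_of :: "int \<Rightarrow> int" where
  "m_of n = (if delta 3 n = 0 then n div 3 - 1
             else if delta 3 n = 1 then (n - 1) div 3
             else (n - 5) div 3)"

definition x_res :: "(nat \<Rightarrow> int) \<Rightarrow> nat \<Rightarrow> int \<Rightarrow> int" where
  "x_res p i n = (if delta 3 n = 0 then a_coef (p i)
                  else if delta 3 n = 1 then a_coef (p i)
                  else b_coef (p i))"

definition y_res :: "(nat \<Rightarrow> int) \<Rightarrow> nat \<Rightarrow> int \<Rightarrow> int" where
  "y_res p i n = (if delta 3 n = 0 then delta (p i) (m_of n - b_coef (p i))
                  else if delta 3 n = 1 then delta (p i) (m_of n - a_coef (p i))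
                  else delta (p i) (m_of n - b_coef (p i)))"

text \<open>In \<open>w\<close> and \<open>s\<close> the index \<open>j\<close> ranges over \<open>{0, 1, 2}\<close> and \<open>{1, 2}\<close>, respectively.\<close>

definition w :: "(nat \<Rightarrow> int) \<Rightarrow> nat \<Rightarrow> nat \<Rightarrow> int \<Rightarrow> int" where
  "w p i j n = (if j = 0 then 1 else if j = 1 then - (1 - eps p i n) else - 1)"

definition s :: "(nat \<Rightarrow> int) \<Rightarrow> nat \<Rightarrow> nat \<Rightarrow> int \<Rightarrow> int" where
  "s p i j n = (if j = 1 then x_res p i n else y_res p i n)"

definition W :: "nat \<Rightarrow> (nat \<Rightarrow> int) \<Rightarrow> (nat \<Rightarrow> nat) \<Rightarrow> int \<Rightarrow> int" where
  "W r p \<alpha> n = (\<Prod>i\<in>{1..r}. w p i (\<alpha> i) n)"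

definition I_supp :: "nat \<Rightarrow> (nat \<Rightarrow> nat) \<Rightarrow> nat set" where
  "I_supp r \<alpha> = {i \<in> {1..r}. \<alpha> i \<noteq> 0}"

definition Q_prod :: "nat \<Rightarrow> (nat \<Rightarrow> int) \<Rightarrow> (nat \<Rightarrow> nat) \<Rightarrow> int" where
  "Q_prod r p \<alpha> = (\<Prod>i\<in>I_supp r \<alpha>. p i)"

definition eta :: "nat \<Rightarrow> (nat \<Rightarrow> int) \<Rightarrow> (nat \<Rightarrow> nat) \<Rightarrow> int \<Rightarrow> int" where
  "eta r p \<alpha> n =
     (if I_supp r \<alpha> = {} then 0
      else (THE e. e \<in> {0..Q_prod r p \<alpha> - 1} \<and>
                   (\<forall>i\<in>I_supp r \<alpha>. delta (p i) e = s p i (\<alpha> i) n)))"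

definition L_count :: "int \<Rightarrow> int \<Rightarrow> int \<Rightarrow> nat" where
  "L_count m q a = card {z::int. 0 \<le> z \<and> z \<le> m \<and> delta q z = a}"

text \<open>
  \<open>{0,1,2}\<^sup>r\<close> is the extensional function space, so that each multi-index is counted once.
\<close>

definition multi_indices :: "nat \<Rightarrow> (nat \<Rightarrow> nat) set" where
  "multi_indices r = {1..r} \<rightarrow>\<^sub>E {0, 1, 2}"

definition B_P :: "nat \<Rightarrow> (nat \<Rightarrow> int) \<Rightarrow> int \<Rightarrow> real" where
  "B_P r p n =
     (\<Sum>\<alpha>\<in>{\<alpha> \<in> multi_indices r. \<exists>i\<in>{1..r}. \<alpha> i \<noteq> 0}.
        real_of_int (W r p \<alpha> n) *
        (real (L_count (m_of n) (Q_prod r p \<alpha>) (eta r p \<alpha> n))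
          - (real_of_int (m_of n) + 1) / real_of_int (Q_prod r p \<alpha>)))"

definition E_P :: "nat \<Rightarrow> (nat \<Rightarrow> int) \<Rightarrow> int \<Rightarrow> real" where
  "E_P r p n =
     (if delta 3 n = 0 then B_P r p n
      else if delta 3 n = 1 then
        (B_P r p n + real_of_int (D_P r p n)) / 2
          + real_of_int (A_P r p n) / (3 * real_of_int (P_prod r p))
      else
        (B_P r p n + real_of_int (D_P r p n)) / 2
          - real_of_int (A_P r p n) / (3 * real_of_int (P_prod r p)))"

end

theory Submission
  imports Defs "HOL-Number_Theory.Cong"
begin

text \<open>
  Write \<open>h = 6z + c\<close> and \<open>2n - h = 6(m - z) + d\<close> with \<open>c, d \<in> {1, 5}\<close>. The prime \<open>p\<^sub>i\<close> then
  excludes two residue classes of \<open>z\<close>, which coincide exactly when \<open>p\<^sub>i\<close> divides \<open>n\<close>. Expanding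
  \<open>\<Prod>\<^sub>i (1 - (1 - \<epsilon>\<^sub>i) [z \<equiv> x\<^sub>i] - [z \<equiv> y\<^sub>i])\<close> and combining the congruences by the Chinese
  remainder theorem counts the admissible \<open>z\<close>; replacing each count by the mean \<open>(m + 1) / Q\<close>
  gives the main term, and each replacement costs less than 1.
  If \<open>n \<equiv> 0 (mod 3)\<close>, then \<open>{c, d} = {1, 5}\<close> and each unordered pair comes from one \<open>z\<close>; otherwise
  \<open>c = d\<close> and every pair is counted twice, except for \<open>h = k = n\<close>.
\<close>

section \<open>Residue classes\<close>

text \<open>Induction on \<open>A\<close>: the new modulus is coprime to the product of the old
  ones, so the two-modulus theorem glues, and a congruence modulo that product descends to each
  factor.\<close>

lemma int_chinese_remainder_exists:
  fixes q :: "'a \<Rightarrow> int" and u :: "'a \<Rightarrow> int"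
  assumes "finite A" and "\<And>i j. i \<in> A \<Longrightarrow> j \<in> A \<Longrightarrow> i \<noteq> j \<Longrightarrow> coprime (q i) (q j)"
  shows "\<exists>z. \<forall>i\<in>A. [z = u i] (mod q i)"
  using assms
proof (induction A rule: finite_induct)
  case (insert a A)
  then obtain z where z: "\<forall>i\<in>A. [z = u i] (mod q i)"
    by blast
  have "coprime (q a) (\<Prod>i\<in>A. q i)"
    using insert.hyps(2) insert.prems by (intro prod_coprime_right) blast
  then obtain y where y: "[y = u a] (mod q a)" "[y = z] (mod (\<Prod>i\<in>A. q i))"
    using binary_chinese_remainder_int by blast
  have "[y = u i] (mod q i)" if "i \<in> A" for i
    using cong_dvd_modulus[OF y(2) dvd_prodI[OF insert.hyps(1) that]] z that cong_trans by blast
  with y(1) show ?case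
    by blast
qed simp

text \<open>Agreement modulo all \<open>q i\<close> forces agreement modulo their product. The first
  claim makes the description in \<open>eta\<close> well defined; the second merges the conditions
  chosen by a multi-index into one congruence.\<close>

lemma int_chinese_remainder_mod:
  fixes q :: "'a \<Rightarrow> int" and u :: "'a \<Rightarrow> int"
  assumes "finite A" and coprime: "\<And>i j. i \<in> A \<Longrightarrow> j \<in> A \<Longrightarrow> i \<noteq> j \<Longrightarrow> coprime (q i) (q j)"
    and u: "\<And>i. i \<in> A \<Longrightarrow> 0 \<le> u i \<and> u i < q i"
  shows "\<exists>!e. e \<in> {0..prod q A - 1} \<and> (\<forall>i\<in>A. e mod q i = u i)"
    and "e \<in> {0..prod q A - 1} \<Longrightarrow> \<forall>i\<in>A. e mod q i = u i \<Longrightarrow>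
           z mod prod q A = e \<longleftrightarrow> (\<forall>i\<in>A. z mod q i = u i)"
proof -
  have pos: "prod q A > 0"
    using u by (intro prod_pos) force
  have mod_mod: "z mod prod q A mod q i = z mod q i" if "i \<in> A" for z i
    using that assms(1) by (intro mod_mod_cancel dvd_prodI)
  have unique: "y mod prod q A = z mod prod q A" if "\<forall>i\<in>A. y mod q i = z mod q i" for y z
    using cong_cong_prod_coprime[of A y z q] that coprime by (simp add: cong_def)
  obtain x where x: "\<forall>i\<in>A. [x = u i] (mod q i)"
    using int_chinese_remainder_exists[of A q u] assms(1) coprime by blast
  have "x mod prod q A \<in> {0..prod q A - 1}"
    using pos by simp
  moreover have "\<forall>i\<in>A. x mod prod q A mod q i = u i"
    using x u mod_mod by (simp add: cong_def)
  moreover have "e = e'" if "e \<in> {0..prod q A - 1}" "e' \<in> {0..prod q A - 1}"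
      "\<forall>i\<in>A. e mod q i = u i" "\<forall>i\<in>A. e' mod q i = u i" for e e'
    using unique[of e e'] that by simp
  ultimately show "\<exists>!e. e \<in> {0..prod q A - 1} \<and> (\<forall>i\<in>A. e mod q i = u i)"
    by metis
  assume e: "e \<in> {0..prod q A - 1}" "\<forall>i\<in>A. e mod q i = u i"
  then show "z mod prod q A = e \<longleftrightarrow> (\<forall>i\<in>A. z mod q i = u i)"
    using unique[of z e] mod_mod by fastforce
qed

section \<open>Counting a residue class in an interval\<close>

text \<open>The counted integers are \<open>q * k + a\<close> with \<open>k\<close> from 0 to
  \<open>(m - a) div q\<close>.\<close>

lemma L_count_eq:
  assumes "m \<ge> -1" "0 \<le> a" "a < q"
  shows "int (L_count m q a) = 1 + (m - a) div q"
proof -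
  have "{z. 0 \<le> z \<and> z \<le> m \<and> delta q z = a} = (\<lambda>k. q * k + a) ` {0..(m - a) div q}"
    (is "?L = ?R")
  proof
    show "?L \<subseteq> ?R"
    proof
      fix z assume z: "z \<in> ?L"
      then have z_eq: "z = q * (z div q) + a"
        using mult_div_mod_eq[of q z] by (simp add: delta_def)
      have "z div q \<le> (m - a) div q"
      proof -
        have "(z - a) div q = z div q"
          using z_eq assms by (metis add_diff_cancel_right' nonzero_mult_div_cancel_left
              order.strict_trans1 order_less_irrefl)
        then show ?thesis
          using z assms zdiv_mono1[of "z - a" "m - a" q] by simp
      qed
      moreover have "0 \<le> z div q"
        using z assms by (simp add: pos_imp_zdiv_nonneg_iff)
      ultimately show "z \<in> ?R"
        using z_eq by auto
    qed
    have "q * k + a \<le> m" if "k \<le> (m - a) div q" for k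
    proof -
      have "q * k \<le> q * ((m - a) div q)"
        using that assms by (intro mult_left_mono) auto
      also have "\<dots> \<le> m - a"
        using assms mult_div_mod_eq[of q "m - a"] pos_mod_sign[of q "m - a"] by linarith
      finally show ?thesis
        by simp
    qed
    then show "?R \<subseteq> ?L"
      using assms by (auto simp: delta_def)
  qed
  moreover have "inj_on (\<lambda>k. q * k + a) {0..(m - a) div q}"
    using assms by (auto simp: inj_on_def)
  ultimately have "L_count m q a = nat ((m - a) div q + 1)"
    by (simp add: L_count_def card_image)
  \<comment> \<open>Since \<open>m - a \<ge> - q\<close>, the quotient is at least -1, so
    \<open>nat\<close> truncates nothing.\<close>
  moreover have "(m - a) div q \<ge> (- q) div q"
    using assms by (intro zdiv_mono1) auto
  moreover have "(- q) div q = -1"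
    using assms nonzero_mult_div_cancel_left[of q "-1"] by simp
  ultimately show ?thesis
    by simp
qed

text \<open>With \<open>b\<close> the remainder of \<open>m - a\<close>, the deviation is
  \<open>(q - 1 - a - b) / q\<close>; as \<open>a\<close> and \<open>b\<close> lie between 0 and
  \<open>q - 1\<close>, the numerator has absolute value at most \<open>q - 1\<close>.\<close>

lemma L_count_deviation:
  assumes "m \<ge> -1" "0 \<le> a" "a < q"
  shows "\<bar>real (L_count m q a) - (real_of_int m + 1) / real_of_int q\<bar> < 1"
proof -
  define b where "b = (m - a) mod q"
  have b: "0 \<le> b" "b < q"
    using assms by (auto simp: b_def)
  have "q * int (L_count m q a) = q + (m - a - b)"
    using L_count_eq[OF assms] mult_div_mod_eq[of q "m - a"] by (simp add: b_def algebra_simps)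
  then have "real_of_int q * real (L_count m q a) = real_of_int (q + (m - a - b))"
    by (metis of_int_mult of_int_of_nat_eq)
  then have "real (L_count m q a) - (real_of_int m + 1) / real_of_int q
      = real_of_int (q - a - b - 1) / real_of_int q"
    using assms by (simp add: field_simps)
  moreover have "\<bar>real_of_int (q - a - b - 1)\<bar> < real_of_int q"
    using assms b by linarith
  ultimately show ?thesis
    using assms by (simp add: abs_divide del: of_int_diff)
qed

section \<open>Pairs of units\<close>

text \<open>Here \<open>z\<close> stands for the pair \<open>6 * z + c\<close>,
  \<open>6 * (m - z) + d\<close> with sum \<open>6 * m + c + d\<close>. For \<open>c\<close> and
  \<open>d\<close> in {1, 5} coprimality to 6 is automatic, so only the primes \<open>p i\<close>
  remain to be tested.\<close>

definition admissible :: "nat \<Rightarrow> (nat \<Rightarrow> int) \<Rightarrow> int \<Rightarrow> int \<Rightarrow> int \<Rightarrow> int set" where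
  "admissible r p c d m =
     {z \<in> {0..m}. \<forall>i\<in>{1..r}. \<not> p i dvd 6 * z + c \<and> \<not> p i dvd 6 * (m - z) + d}"

text \<open>The ordered counterpart of \<open>g_P\<close>: \<open>h\<close> encodes the pair
  \<open>(h, N - h)\<close>, without \<open>h \<le> k\<close>.\<close>

definition unit_summands :: "int \<Rightarrow> int \<Rightarrow> int set" where
  "unit_summands M N = {h. 0 < h \<and> h < N \<and> coprime h M \<and> coprime (N - h) M}"

lemma finite_unit_summands [simp]: "finite (unit_summands M N)"
  by (rule finite_subset[of _ "{0..N}"]) (auto simp: unit_summands_def)

lemma coprime_6_iff: "coprime h 6 \<longleftrightarrow> h mod 6 \<in> {1, 5}" for h :: int
proof -
  have "coprime k 6 \<longleftrightarrow> k \<in> {1, 5}" if "k \<in> {0, 1, 2, 3, 4, 5}" for k :: int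
    using that by (elim insertE emptyE) (simp_all add: coprime_iff_gcd_eq_1 gcd_non_0_int)
  moreover have "h mod 6 \<in> {0, 1, 2, 3, 4, 5}"
    by simp presburger
  ultimately have "coprime (h mod 6) 6 \<longleftrightarrow> h mod 6 \<in> {1, 5}" .
  then show ?thesis
    by simp
qed

lemma coprime_M_mod_iff:
  assumes "\<And>i. i \<in> {1..r} \<Longrightarrow> prime (p i)"
  shows "coprime h (M_mod r p) \<longleftrightarrow> h mod 6 \<in> {1, 5} \<and> (\<forall>i\<in>{1..r}. \<not> p i dvd h)"
proof -
  have "coprime h (p i) \<longleftrightarrow> \<not> p i dvd h" if "i \<in> {1..r}" for i
    using assms[OF that] prime_imp_coprime[of "p i" h]
    by (metis coprime_commute coprime_common_divisor dvd_refl not_prime_unit)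
  moreover have "coprime h (\<Prod>i\<in>{1..r}. p i) \<longleftrightarrow> (\<forall>i\<in>{1..r}. coprime h (p i))"
    by (meson coprime_divisors dvd_prodI dvd_refl finite_atLeastAtMost prod_coprime_right)
  ultimately show ?thesis
    by (simp add: M_mod_def P_prod_def coprime_6_iff)
qed

text \<open>The reflection \<open>h\<close> to \<open>2 * n - h\<close> exchanges the summands up to
  \<open>n\<close> with those from \<open>n\<close> on. The halves overlap only in
  \<open>h = n\<close>, which occurs exactly when \<open>D_P\<close> is 1.\<close>

lemma double_g_P:
  assumes "n > 0"
  shows "2 * int (g_P r p (2 * n)) = int (card (unit_summands (M_mod r p) (2 * n))) + D_P r p n"
proof -
  let ?S = "unit_summands (M_mod r p) (2 * n)"
  let ?low = "{h \<in> ?S. h \<le> n}" and ?high = "{h \<in> ?S. n \<le> h}"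
  have "bij_betw (\<lambda>h. (h, 2 * n - h)) ?low
      {(h, k). h > 0 \<and> k > 0 \<and> h + k = 2 * n \<and> h \<le> k \<and> gcd h (M_mod r p) = 1 \<and> gcd k (M_mod r p) = 1}"
    by (rule bij_betw_byWitness[where f' = fst])
      (auto simp: unit_summands_def, metis add_diff_cancel_left')
  then have low: "g_P r p (2 * n) = card ?low"
    by (simp add: g_P_def bij_betw_same_card)
  have "bij_betw (\<lambda>h. 2 * n - h) ?low ?high"
    by (rule bij_betw_byWitness[where f' = "\<lambda>h. 2 * n - h"]) (auto simp: unit_summands_def)
  then have high: "card ?low = card ?high"
    by (rule bij_betw_same_card)
  have union: "?low \<union> ?high = ?S"
    by auto
  have "?low \<inter> ?high = (if coprime n (M_mod r p) then {n} else {})"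
    using assms by (auto simp: unit_summands_def)
  then have "int (card (?low \<inter> ?high)) = D_P r p n"
    by (simp add: D_P_def M_mod_def flip: coprime_iff_gcd_eq_1)
  moreover have "card ?low + card ?high = card ?S + card (?low \<inter> ?high)"
    using card_Un_Int[of ?low ?high] union by simp
  ultimately show ?thesis
    using low high by linarith
qed

lemma unit_summands_mod_6:
  assumes "\<And>i. i \<in> {1..r} \<Longrightarrow> prime (p i)"
    and c: "c \<in> {1, 5}" and d: "d \<in> {1, 5}" and N: "N = 6 * m + c + d"
  shows "card {h \<in> unit_summands (M_mod r p) N. h mod 6 = c} = card (admissible r p c d m)"
proof -
  have coprime_M: "coprime h (M_mod r p) \<longleftrightarrow> h mod 6 \<in> {1, 5} \<and> (\<forall>i\<in>{1..r}. \<not> p i dvd h)" for h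
    using coprime_M_mod_iff[of r p h] assms(1) by blast
  have "bij_betw (\<lambda>z. 6 * z + c) (admissible r p c d m)
      {h \<in> unit_summands (M_mod r p) N. h mod 6 = c}"
  proof (rule bij_betw_byWitness[where f' = "\<lambda>h. h div 6"])
    show "\<forall>z\<in>admissible r p c d m. (6 * z + c) div 6 = z"
      using c by auto
    show "\<forall>h\<in>{h \<in> unit_summands (M_mod r p) N. h mod 6 = c}. 6 * (h div 6) + c = h"
      using mult_div_mod_eq[of 6] by auto
    show "(\<lambda>z. 6 * z + c) ` admissible r p c d m
        \<subseteq> {h \<in> unit_summands (M_mod r p) N. h mod 6 = c}"
    proof (rule image_subsetI)
      fix z assume z: "z \<in> admissible r p c d m"
      have k_eq: "N - (6 * z + c) = 6 * (m - z) + d"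
        by (simp add: N)
      have "(6 * z + c) mod 6 = c" "(6 * (m - z) + d) mod 6 = d"
        using c d by (auto simp del: right_diff_distrib right_diff_distrib_numeral)
      then have "coprime (6 * z + c) (M_mod r p)" "coprime (6 * (m - z) + d) (M_mod r p)"
        using z c d unfolding coprime_M admissible_def by auto
      then have "coprime (6 * z + c) (M_mod r p)" "coprime (N - (6 * z + c)) (M_mod r p)"
        unfolding k_eq .
      moreover have "0 < 6 * z + c" "6 * z + c < N"
        using c d z by (auto simp: admissible_def N)
      ultimately show "6 * z + c \<in> {h \<in> unit_summands (M_mod r p) N. h mod 6 = c}"
        using c by (auto simp: unit_summands_def)
    qed
    show "(\<lambda>h. h div 6) ` {h \<in> unit_summands (M_mod r p) N. h mod 6 = c} \<subseteq> admissible r p c d m"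
    proof (rule image_subsetI)
      fix h assume h: "h \<in> {h \<in> unit_summands (M_mod r p) N. h mod 6 = c}"
      define z where "z = h div 6"
      have h_eq: "h = 6 * z + c"
        using h mult_div_mod_eq[of 6 h] by (auto simp: z_def)
      then have k_eq: "N - h = 6 * (m - z) + d"
        by (simp add: N)
      have "0 < 6 * z + c" "0 < 6 * (m - z) + d"
        using h unfolding h_eq[symmetric] k_eq[symmetric] by (simp_all add: unit_summands_def)
      \<comment> \<open>Positivity suffices because \<open>c\<close> and \<open>d\<close> are less
        than 6.\<close>
      then have "0 \<le> z" "z \<le> m"
        using c d by auto
      moreover have "\<forall>i\<in>{1..r}. \<not> p i dvd 6 * z + c \<and> \<not> p i dvd 6 * (m - z) + d"
        using h unfolding h_eq[symmetric] k_eq[symmetric] unit_summands_def coprime_M by blast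
      ultimately show "h div 6 \<in> admissible r p c d m"
        by (simp add: admissible_def flip: z_def)
    qed
  qed
  then show ?thesis
    by (simp add: bij_betw_same_card)
qed

text \<open>The class of \<open>n\<close> modulo 3 fixes \<open>2 * n\<close> modulo 6, hence which
  pairs of residues from {1, 5} can occur: 1 with 5, only 1 with 1, or only 5 with 5.\<close>

lemma double_g_P_admissible:
  assumes "\<And>i. i \<in> {1..r} \<Longrightarrow> prime (p i)" and "n > 0"
  shows "n mod 3 = 0 \<Longrightarrow> int (g_P r p (2 * n)) = int (card (admissible r p 1 5 (n div 3 - 1)))"
    and "n mod 3 = 1 \<Longrightarrow>
      2 * int (g_P r p (2 * n)) = int (card (admissible r p 1 1 ((n - 1) div 3))) + D_P r p n"
    and "n mod 3 = 2 \<Longrightarrow>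
      2 * int (g_P r p (2 * n)) = int (card (admissible r p 5 5 ((n - 5) div 3))) + D_P r p n"
proof -
  let ?S = "unit_summands (M_mod r p) (2 * n)"
  let ?T = "\<lambda>c. {h \<in> ?S. h mod 6 = c}"
  have residue: "h mod 6 \<in> {1, 5}" if "coprime h (M_mod r p)" for h
    using that coprime_M_mod_iff[of r p h] assms(1) by blast
  have "?S = ?T 1 \<union> ?T 5"
    using residue by (auto simp: unit_summands_def)
  then have "card ?S = card (?T 1 \<union> ?T 5)"
    by metis
  also have "\<dots> = card (?T 1) + card (?T 5)"
    by (rule card_Un_disjoint) auto
  finally have split: "card ?S = card (?T 1) + card (?T 5)" .
  note g = double_g_P[OF assms(2), of r p, unfolded split]
  have partner: "(2 * n - h) mod 6 \<in> {1, 5}" if "h \<in> ?S" for h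
    using that residue by (simp add: unit_summands_def)
  show "int (g_P r p (2 * n)) = int (card (admissible r p 1 5 (n div 3 - 1)))" if "n mod 3 = 0"
  proof -
    \<comment> \<open>The pair \<open>h = k = n\<close> is impossible, as 3 divides
      \<open>n\<close>.\<close>
    have "\<not> coprime n 6"
      using that unfolding coprime_6_iff by simp presburger
    then have "D_P r p n = 0"
      by (simp add: D_P_def flip: coprime_iff_gcd_eq_1)
    \<comment> \<open>Reflection swaps the two classes, so the factor 2 cancels and one class is
      enough.\<close>
    moreover have "bij_betw (\<lambda>h. 2 * n - h) (?T 1) (?T 5)"
    proof (rule bij_betw_byWitness[where f' = "\<lambda>h. 2 * n - h"])
      have "(2 * n - h) mod 6 = 5" if "h mod 6 = 1" for h
        using that \<open>n mod 3 = 0\<close> by presburger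
      then show "(\<lambda>h. 2 * n - h) ` ?T 1 \<subseteq> ?T 5"
        by (auto simp: unit_summands_def)
      have "(2 * n - h) mod 6 = 1" if "h mod 6 = 5" for h
        using that \<open>n mod 3 = 0\<close> by presburger
      then show "(\<lambda>h. 2 * n - h) ` ?T 5 \<subseteq> ?T 1"
        by (auto simp: unit_summands_def)
    qed auto
    then have "card (?T 1) = card (?T 5)"
      by (rule bij_betw_same_card)
    moreover have "2 * n = 6 * (n div 3 - 1) + 1 + 5"
      using that by presburger
    then have "card (?T 1) = card (admissible r p 1 5 (n div 3 - 1))"
      by (intro unit_summands_mod_6 assms(1)) auto
    ultimately show ?thesis
      using g by linarith
  qed
  show "2 * int (g_P r p (2 * n)) = int (card (admissible r p 1 1 ((n - 1) div 3))) + D_P r p n"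
    if "n mod 3 = 1"
  proof -
    \<comment> \<open>Here \<open>2 * n\<close> is 2 modulo 6, so a summand congruent to 5 has a
      partner divisible by 3.\<close>
    have "(2 * n - h) mod 6 = 3" if "h mod 6 = 5" for h
      using that \<open>n mod 3 = 1\<close> by presburger
    then have "?T 5 = {}"
      using partner by fastforce
    moreover have "2 * n = 6 * ((n - 1) div 3) + 1 + 1"
      using that by presburger
    then have "card (?T 1) = card (admissible r p 1 1 ((n - 1) div 3))"
      by (intro unit_summands_mod_6 assms(1)) auto
    ultimately show ?thesis
      using g by simp
  qed
  show "2 * int (g_P r p (2 * n)) = int (card (admissible r p 5 5 ((n - 5) div 3))) + D_P r p n"
    if "n mod 3 = 2"
  proof -
    have "(2 * n - h) mod 6 = 3" if "h mod 6 = 1" for h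
      using that \<open>n mod 3 = 2\<close> by presburger
    then have "?T 1 = {}"
      using partner by fastforce
    moreover have "2 * n = 6 * ((n - 5) div 3) + 5 + 5"
      using that by presburger
    then have "card (?T 5) = card (admissible r p 5 5 ((n - 5) div 3))"
      by (intro unit_summands_mod_6 assms(1)) auto
    ultimately show ?thesis
      using g by simp
  qed
qed

section \<open>The excluded residue classes\<close>

text \<open>The root modulo \<open>q\<close> of \<open>6 * z + c\<close> for \<open>c\<close> in {1,
  5}. The root for 5 is the reflection of the root for 1, since
  \<open>6 * (-1 - z) + 5 = - (6 * z + 1)\<close>.\<close>

definition excluded_class :: "int \<Rightarrow> int \<Rightarrow> int" where
  "excluded_class c q = (if c = 1 then a_coef q else b_coef q)"

lemma excluded_class:
  assumes q: "prime q" "q \<ge> 5" and c: "c \<in> {1, 5}"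
  shows "0 \<le> excluded_class c q" "excluded_class c q < q"
    and "q dvd 6 * z + c \<longleftrightarrow> z mod q = excluded_class c q"
proof -
  have "coprime 2 q" "coprime 3 q"
    using q prime_odd_int[of q] by (auto intro!: primes_coprime)
  then have "coprime (2 * 3) q"
    unfolding coprime_mult_left_iff by blast
  then have six: "coprime 6 q"
    by simp
  then have residue: "q mod 6 = 1 \<or> q mod 6 = 5"
    using coprime_6_iff[of q] by (simp add: coprime_commute)
  \<comment> \<open>Both 1 and 5 are their own inverses modulo 6, which makes the division in
    \<open>a_coef\<close> exact.\<close>
  then have "(q * (q mod 6)) mod 6 = 1"
    by (elim disjE; simp; presburger)
  then have a: "6 * a_coef q = q * (q mod 6) - 1"
    using mod_eq_dvd_iff[of "q * (q mod 6)" 6 1] by (simp add: a_coef_def delta_def)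
  have a_bounds: "0 \<le> a_coef q" "a_coef q < q"
    using a residue q by auto
  then show "0 \<le> excluded_class c q" "excluded_class c q < q"
    by (auto simp: excluded_class_def b_coef_def)
  have "\<exists>t. 6 * excluded_class c q + c = q * t"
  proof (cases "c = 1")
    case True
    then show ?thesis
      using a by (auto simp: excluded_class_def)
  next
    case False
    then have "6 * excluded_class c q + c = q * (6 - q mod 6)"
      using a c by (auto simp: excluded_class_def b_coef_def algebra_simps)
    then show ?thesis
      by blast
  qed
  \<comment> \<open>Substituting this for \<open>c\<close> leaves 6 times the distance of
    \<open>z\<close> from the root, up to a multiple of \<open>q\<close>; then 6 cancels.\<close>
  then obtain t where "c = q * t - 6 * excluded_class c q"
    by (metis add_diff_cancel_left')
  then have "6 * z + c = 6 * (z - excluded_class c q) + q * t"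
    by simp
  then have "q dvd 6 * z + c \<longleftrightarrow> q dvd 6 * (z - excluded_class c q)"
    by (metis dvd_add_left_iff dvd_triv_left)
  also have "\<dots> \<longleftrightarrow> q dvd z - excluded_class c q"
    using six by (intro coprime_dvd_mult_right_iff) (simp add: coprime_commute)
  also have "\<dots> \<longleftrightarrow> z mod q = excluded_class c q"
    using \<open>0 \<le> excluded_class c q\<close> \<open>excluded_class c q < q\<close>
    by (simp add: mod_eq_dvd_iff[symmetric])
  finally show "q dvd 6 * z + c \<longleftrightarrow> z mod q = excluded_class c q" .
qed

section \<open>Sieving by two residue classes per prime\<close>

text \<open>The shared setting of the three cases modulo 3, with \<open>(c, d)\<close> equal to (1,
  5), (1, 1) or (5, 5). The last two assumptions absorb the case distinctions in
  \<open>x_res\<close> and \<open>y_res\<close>.\<close>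

locale two_residues =
  fixes r :: nat and p :: "nat \<Rightarrow> int" and n c d m :: int
  assumes prime: "i \<in> {1..r} \<Longrightarrow> prime (p i)"
    and ge_5: "i \<in> {1..r} \<Longrightarrow> p i \<ge> 5"
    and inj: "inj_on p {1..r}"
    and c: "c \<in> {1, 5}" and d: "d \<in> {1, 5}"
    and m: "m = m_of n" "m \<ge> -1" "2 * n = 6 * m + c + d"
    and x_res: "i \<in> {1..r} \<Longrightarrow> x_res p i n = excluded_class c (p i)"
    and y_res: "i \<in> {1..r} \<Longrightarrow> y_res p i n = (m - excluded_class d (p i)) mod p i"
begin

lemma s_bounds: "i \<in> {1..r} \<Longrightarrow> 0 \<le> s p i j n \<and> s p i j n < p i"
  using excluded_class(1,2)[OF prime ge_5 c] ge_5[of i] x_res y_res by (simp add: s_def)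

lemma dvd_first_iff:
  "i \<in> {1..r} \<Longrightarrow> p i dvd 6 * z + c \<longleftrightarrow> z mod p i = x_res p i n"
  using excluded_class(3)[OF prime ge_5 c] x_res by simp

text \<open>The second summand has the shape of the first with \<open>m - z\<close> for
  \<open>z\<close>, so its excluded class is reflected by \<open>m\<close>.\<close>

lemma dvd_second_iff:
  assumes "i \<in> {1..r}"
  shows "p i dvd 6 * (m - z) + d \<longleftrightarrow> z mod p i = y_res p i n"
proof -
  let ?e = "excluded_class d (p i)"
  have "?e mod p i = ?e"
    using excluded_class(1,2)[OF prime ge_5 d] assms by simp
  then have "p i dvd 6 * (m - z) + d \<longleftrightarrow> (m - z) mod p i = ?e mod p i"
    using excluded_class(3)[OF prime[OF assms] ge_5[OF assms] d] by metis
  also have "\<dots> \<longleftrightarrow> p i dvd (m - z) - ?e"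
    by (rule mod_eq_dvd_iff)
  also have "\<dots> \<longleftrightarrow> p i dvd z - (m - ?e)"
    by (metis diff_diff_eq2 diff_right_commute dvd_minus_iff minus_diff_eq diff_diff_eq add.commute)
  finally show ?thesis
    using y_res[OF assms] by (simp add: mod_eq_dvd_iff)
qed

text \<open>At \<open>z = x_res p i n\<close> the first summand is divisible by \<open>p i\<close>,
  so the second is too exactly when the sum \<open>2 * n\<close> is; and \<open>p i\<close> is
  odd.\<close>

lemma x_res_eq_y_res_iff:
  assumes i: "i \<in> {1..r}"
  shows "x_res p i n = y_res p i n \<longleftrightarrow> p i dvd n"
proof -
  define x where "x = x_res p i n"
  have x: "x mod p i = x"
    using s_bounds[OF i, of 1] by (simp add: x_def s_def)
  then have first: "p i dvd 6 * x + c"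
    using dvd_first_iff[OF i] x_def by simp
  have "x = y_res p i n \<longleftrightarrow> p i dvd 6 * (m - x) + d"
    using dvd_second_iff[OF i] x by simp
  also have "\<dots> \<longleftrightarrow> p i dvd (6 * x + c) + (6 * (m - x) + d)"
    using first by (simp only: dvd_add_right_iff)
  also have "(6 * x + c) + (6 * (m - x) + d) = 2 * n"
    using m(3) by simp
  also have "p i dvd 2 * n \<longleftrightarrow> p i dvd n"
    using prime[OF i] ge_5[OF i] primes_coprime[of "p i" 2]
    by (intro coprime_dvd_mult_right_iff) auto
  finally show ?thesis
    by (simp add: x_def)
qed

text \<open>The term \<open>j = 0\<close> is 1, and the others subtract the two excluded classes. If
  these coincide, \<open>eps\<close> removes the term \<open>j = 1\<close>, so the class is
  subtracted only once.\<close>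

lemma admissible_factor:
  assumes i: "i \<in> {1..r}"
  shows "of_bool (\<not> p i dvd 6 * z + c \<and> \<not> p i dvd 6 * (m - z) + d)
    = (\<Sum>j\<in>{0, 1, 2}. w p i j n * of_bool (j \<noteq> 0 \<longrightarrow> z mod p i = s p i j n))"
  unfolding dvd_first_iff[OF i] dvd_second_iff[OF i]
  using x_res_eq_y_res_iff[OF i]
  by (auto simp: w_def s_def eps_def delta_def dvd_eq_mod_eq_0)

lemma eta_mod_iff:
  "0 \<le> eta r p \<alpha> n" "eta r p \<alpha> n < Q_prod r p \<alpha>"
  "z mod Q_prod r p \<alpha> = eta r p \<alpha> n \<longleftrightarrow> (\<forall>i\<in>I_supp r \<alpha>. z mod p i = s p i (\<alpha> i) n)"
proof -
  define I where "I = I_supp r \<alpha>"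
  have I: "finite I" "I \<subseteq> {1..r}"
    by (auto simp: I_def I_supp_def)
  have coprime: "coprime (p i) (p j)" if "i \<in> I" "j \<in> I" "i \<noteq> j" for i j
    using that I prime inj by (intro primes_coprime) (auto simp: inj_on_eq_iff subset_iff)
  have s: "0 \<le> s p i (\<alpha> i) n \<and> s p i (\<alpha> i) n < p i" if "i \<in> I" for i
    using s_bounds that I by blast
  note crt = int_chinese_remainder_mod[of I p "\<lambda>i. s p i (\<alpha> i) n", OF I(1) coprime s]
  \<comment> \<open>For empty support \<open>eta\<close> is 0 by convention and the modulus is 1, so
    the claim still holds.\<close>
  have "eta r p \<alpha> n \<in> {0..prod p I - 1} \<and> (\<forall>i\<in>I. eta r p \<alpha> n mod p i = s p i (\<alpha> i) n)"
  proof (cases "I = {}")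
    case False
    then have "eta r p \<alpha> n
        = (THE e. e \<in> {0..prod p I - 1} \<and> (\<forall>i\<in>I. e mod p i = s p i (\<alpha> i) n))"
      by (simp add: eta_def Q_prod_def delta_def I_def)
    then show ?thesis
      using theI'[OF crt(1)] by simp
  qed (simp add: eta_def I_def)
  then show "0 \<le> eta r p \<alpha> n" "eta r p \<alpha> n < Q_prod r p \<alpha>"
    "z mod Q_prod r p \<alpha> = eta r p \<alpha> n \<longleftrightarrow> (\<forall>i\<in>I_supp r \<alpha>. z mod p i = s p i (\<alpha> i) n)"
    using crt(2)[of "eta r p \<alpha> n" z] by (simp_all add: Q_prod_def I_def)
qed

section \<open>The inclusion-exclusion count\<close>

lemma card_admissible:
  "int (card (admissible r p c d m))
    = (\<Sum>\<alpha>\<in>multi_indices r. W r p \<alpha> n * int (L_count m (Q_prod r p \<alpha>) (eta r p \<alpha> n)))"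
proof -
  have "int (card (admissible r p c d m)) = (\<Sum>z\<in>{0..m}. of_bool (z \<in> admissible r p c d m))"
    by (simp add: admissible_def Int_def)
  also have "\<dots> = (\<Sum>z\<in>{0..m}. \<Prod>i\<in>{1..r}.
      of_bool (\<not> p i dvd 6 * z + c \<and> \<not> p i dvd 6 * (m - z) + d))"
    by (intro sum.cong refl) (auto simp: admissible_def of_bool_def)
  also have "\<dots> = (\<Sum>z\<in>{0..m}. \<Prod>i\<in>{1..r}. \<Sum>j\<in>{0, 1, 2}.
      w p i j n * of_bool (j \<noteq> 0 \<longrightarrow> z mod p i = s p i j n))"
    by (intro sum.cong prod.cong refl admissible_factor)
  \<comment> \<open>Distributivity: a multi-index selects one term \<open>j\<close> from each
    factor.\<close>
  also have "\<dots> = (\<Sum>z\<in>{0..m}. \<Sum>\<alpha>\<in>multi_indices r. \<Prod>i\<in>{1..r}.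
      w p i (\<alpha> i) n * of_bool (\<alpha> i \<noteq> 0 \<longrightarrow> z mod p i = s p i (\<alpha> i) n))"
    unfolding multi_indices_def by (intro sum.cong refl prod_sum_PiE) auto
  also have "\<dots> = (\<Sum>\<alpha>\<in>multi_indices r. \<Sum>z\<in>{0..m}. W r p \<alpha> n *
      of_bool (delta (Q_prod r p \<alpha>) z = eta r p \<alpha> n))"
  proof (subst sum.swap, intro sum.cong refl)
    fix \<alpha> z
    \<comment> \<open>A product of indicators is the indicator of the conjunction, which the Chinese
      remainder theorem turns into one congruence modulo \<open>Q_prod r p \<alpha>\<close>.\<close>
    have "(\<Prod>i\<in>{1..r}. of_bool (\<alpha> i \<noteq> 0 \<longrightarrow> z mod p i = s p i (\<alpha> i) n))
        = (of_bool (\<forall>i\<in>{1..r}. \<alpha> i \<noteq> 0 \<longrightarrow> z mod p i = s p i (\<alpha> i) n) :: int)"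
      by (auto simp: of_bool_def)
    also have "\<dots> = of_bool (delta (Q_prod r p \<alpha>) z = eta r p \<alpha> n)"
      unfolding delta_def eta_mod_iff by (auto simp: I_supp_def)
    finally show "(\<Prod>i\<in>{1..r}. w p i (\<alpha> i) n * of_bool (\<alpha> i \<noteq> 0 \<longrightarrow> z mod p i = s p i (\<alpha> i) n))
        = W r p \<alpha> n * of_bool (delta (Q_prod r p \<alpha>) z = eta r p \<alpha> n)"
      by (simp only: prod.distrib W_def)
  qed
  also have "\<dots> = (\<Sum>\<alpha>\<in>multi_indices r. W r p \<alpha> n * int (L_count m (Q_prod r p \<alpha>) (eta r p \<alpha> n)))"
  proof (intro sum.cong refl)
    fix \<alpha>
    have "(\<Sum>z\<in>{0..m}. of_bool (delta (Q_prod r p \<alpha>) z = eta r p \<alpha> n))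
        = int (L_count m (Q_prod r p \<alpha>) (eta r p \<alpha> n))"
      by (simp add: L_count_def Int_def conj_assoc)
    then show "(\<Sum>z\<in>{0..m}. W r p \<alpha> n * of_bool (delta (Q_prod r p \<alpha>) z = eta r p \<alpha> n))
        = W r p \<alpha> n * int (L_count m (Q_prod r p \<alpha>) (eta r p \<alpha> n))"
      by (simp only: flip: sum_distrib_left)
  qed
  finally show ?thesis .
qed

section \<open>Main term and error bound\<close>

text \<open>The same expansion read backwards, with each congruence replaced by its density
  \<open>1 / p i\<close>: the local factor is \<open>1 - (1 - eps) / p i - 1 / p i\<close>.\<close>

lemma sum_W_div_Q:
  "(\<Sum>\<alpha>\<in>multi_indices r. real_of_int (W r p \<alpha> n) / real_of_int (Q_prod r p \<alpha>))
    = real_of_int (A_P r p n) / real_of_int (P_prod r p)"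
proof -
  have "(\<Sum>\<alpha>\<in>multi_indices r. real_of_int (W r p \<alpha> n) / real_of_int (Q_prod r p \<alpha>))
      = (\<Sum>\<alpha>\<in>multi_indices r. \<Prod>i\<in>{1..r}.
          real_of_int (w p i (\<alpha> i) n) / (if \<alpha> i = 0 then 1 else real_of_int (p i)))"
  proof (intro sum.cong refl)
    fix \<alpha>
    have "real_of_int (Q_prod r p \<alpha>) = (\<Prod>i\<in>{1..r}. if \<alpha> i = 0 then 1 else real_of_int (p i))"
      unfolding Q_prod_def I_supp_def of_int_prod
      by (subst prod.inter_filter) (auto intro!: prod.cong)
    then show "real_of_int (W r p \<alpha> n) / real_of_int (Q_prod r p \<alpha>) = (\<Prod>i\<in>{1..r}.
          real_of_int (w p i (\<alpha> i) n) / (if \<alpha> i = 0 then 1 else real_of_int (p i)))"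
      by (simp add: W_def prod_dividef)
  qed
  also have "\<dots> = (\<Prod>i\<in>{1..r}. \<Sum>j\<in>{0, 1, 2}.
      real_of_int (w p i j n) / (if j = 0 then 1 else real_of_int (p i)))"
    unfolding multi_indices_def by (rule prod_sum_PiE[symmetric]) auto
  also have "\<dots> = (\<Prod>i\<in>{1..r}. real_of_int (p i - 2 + eps p i n) / real_of_int (p i))"
  proof (intro prod.cong refl)
    fix i assume "i \<in> {1..r}"
    then have "p i \<noteq> 0"
      using ge_5[of i] by auto
    then show "(\<Sum>j\<in>{0, 1, 2}. real_of_int (w p i j n) / (if j = 0 then 1 else real_of_int (p i)))
        = real_of_int (p i - 2 + eps p i n) / real_of_int (p i)"
      by (simp add: w_def field_simps)
  qed
  finally show ?thesis
    by (simp add: A_P_def P_prod_def prod_dividef)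
qed

lemma card_admissible_eq_B_P:
  "real (card (admissible r p c d m))
    = B_P r p n + (real_of_int m + 1) * (real_of_int (A_P r p n) / real_of_int (P_prod r p))"
proof -
  let ?dev = "\<lambda>\<alpha>. real_of_int (W r p \<alpha> n) * (real (L_count m (Q_prod r p \<alpha>) (eta r p \<alpha> n))
          - (real_of_int m + 1) / real_of_int (Q_prod r p \<alpha>))"
  have fin: "finite (multi_indices r)"
    by (simp add: multi_indices_def finite_PiE)
  \<comment> \<open>For the zero multi-index the modulus is 1 and the count is exactly
    \<open>m + 1\<close>, also at \<open>m = -1\<close>, so this index may be added to the sum
    defining \<open>B_P\<close>.\<close>
  have "?dev \<alpha> = 0" if "\<forall>i\<in>{1..r}. \<alpha> i = 0" for \<alpha>
  proof -
    have "I_supp r \<alpha> = {}"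
      using that by (simp add: I_supp_def)
    then show ?thesis
      using L_count_eq[of m 0 1] m(2) by (simp add: Q_prod_def eta_def)
  qed
  then have "B_P r p n = (\<Sum>\<alpha>\<in>multi_indices r. ?dev \<alpha>)"
    unfolding B_P_def m(1)[symmetric] by (intro sum.mono_neutral_left fin) auto
  also have "\<dots> = (\<Sum>\<alpha>\<in>multi_indices r. real_of_int (W r p \<alpha> n) *
        real (L_count m (Q_prod r p \<alpha>) (eta r p \<alpha> n)))
      - (real_of_int m + 1) * (\<Sum>\<alpha>\<in>multi_indices r. real_of_int (W r p \<alpha> n) / real_of_int (Q_prod r p \<alpha>))"
    by (simp add: sum_subtractf sum_distrib_left right_diff_distrib mult.commute)
  also have "(\<Sum>\<alpha>\<in>multi_indices r. real_of_int (W r p \<alpha> n) *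
        real (L_count m (Q_prod r p \<alpha>) (eta r p \<alpha> n))) = real_of_int (int (card (admissible r p c d m)))"
    unfolding card_admissible by simp
  finally show ?thesis
    unfolding sum_W_div_Q by simp
qed

text \<open>There are \<open>3 ^ r - 1\<close> nonzero multi-indices, and each contributes less than
  1 because the weights are at most 1 in absolute value.\<close>

lemma abs_B_P_less:
  assumes "r \<ge> 1"
  shows "\<bar>B_P r p n\<bar> < 3 ^ r - 1"
proof -
  let ?A = "{\<alpha> \<in> multi_indices r. \<exists>i\<in>{1..r}. \<alpha> i \<noteq> 0}"
  let ?zero = "\<lambda>i\<in>{1..r}. 0 :: nat"
  let ?dev = "\<lambda>\<alpha>. real_of_int (W r p \<alpha> n) * (real (L_count m (Q_prod r p \<alpha>) (eta r p \<alpha> n))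
          - (real_of_int m + 1) / real_of_int (Q_prod r p \<alpha>))"
  have fin: "finite (multi_indices r)"
    by (simp add: multi_indices_def finite_PiE)
  have A: "?A = multi_indices r - {?zero}"
    unfolding multi_indices_def by (auto simp: PiE_def extensional_def restrict_def fun_eq_iff)
  have "card (multi_indices r) = 3 ^ r"
    by (simp add: multi_indices_def card_PiE numeral_3_eq_3)
  moreover have "?zero \<in> multi_indices r"
    by (auto simp: multi_indices_def)
  ultimately have card: "card ?A = 3 ^ r - 1"
    unfolding A using fin by simp
  \<comment> \<open>A nonempty index set keeps the summed inequality strict.\<close>
  have "(3::nat) ^ r \<ge> 3 ^ 1"
    using assms by (intro power_increasing) auto
  then have "card ?A \<noteq> 0"
    using card by simp
  then have nonempty: "?A \<noteq> {}"
    by (metis card.empty)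
  have less: "\<bar>?dev \<alpha>\<bar> < 1" for \<alpha>
  proof -
    have "\<bar>W r p \<alpha> n\<bar> = (\<Prod>i\<in>{1..r}. \<bar>w p i (\<alpha> i) n\<bar>)"
      by (simp add: W_def abs_prod)
    also have "\<dots> \<le> 1"
      by (intro prod_le_1) (auto simp: w_def eps_def)
    finally have "\<bar>real_of_int (W r p \<alpha> n)\<bar> \<le> 1"
      by linarith
    moreover note L_count_deviation[OF m(2) eta_mod_iff(1,2), of \<alpha>]
    ultimately show ?thesis
      unfolding abs_mult by (smt (verit) abs_ge_zero mult_left_le_one_le)
  qed
  have "\<bar>B_P r p n\<bar> \<le> (\<Sum>\<alpha>\<in>?A. \<bar>?dev \<alpha>\<bar>)"
    unfolding B_P_def m(1)[symmetric] by (rule sum_abs)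
  also have "\<dots> < (\<Sum>\<alpha>\<in>?A. 1)"
    using less fin nonempty by (intro sum_strict_mono) auto
  also have "\<dots> = 3 ^ r - 1"
    using card by (simp add: of_nat_diff)
  finally show ?thesis .
qed

end

section \<open>Assembling the three classes modulo 3\<close>

theorem theorem5p2:
  fixes r :: nat and p :: "nat \<Rightarrow> int" and n :: int
  assumes "r \<ge> 1"
    and "\<And>i. i \<in> {1..r} \<Longrightarrow> prime (p i)"
    and "\<And>i. i \<in> {1..r} \<Longrightarrow> p i \<ge> 5"
    and "inj_on p {1..r}"
    and "n > 0"
  shows "real (g_P r p (2 * n))
           = real_of_int n / real_of_int (M_mod r p) * real_of_int (kappa_P r p n) + E_P r p n
         \<and> \<bar>E_P r p n\<bar> < 3 ^ r - 1"
proof -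
  define \<rho> where "\<rho> = real_of_int (A_P r p n) / real_of_int (P_prod r p)"
  have P: "P_prod r p > 0"
    using assms(3) unfolding P_prod_def by (intro prod_pos) force
  have A: "0 \<le> A_P r p n" "A_P r p n \<le> P_prod r p"
    using assms(3) unfolding A_P_def P_prod_def
    by (force simp: eps_def intro!: prod_nonneg prod_mono)+
  have \<rho>_bounds: "0 \<le> \<rho>" "\<rho> \<le> 1"
    using A P by (auto simp: \<rho>_def)
  have D: "0 \<le> real_of_int (D_P r p n)" "real_of_int (D_P r p n) \<le> 1"
    by (auto simp: D_P_def)
  \<comment> \<open>In the two halved cases the error is below \<open>3 ^ r / 2 + 1 / 3\<close>,
    which is at most \<open>3 ^ r - 1\<close> once \<open>3 ^ r \<ge> 3\<close>.\<close>
  have "(3::real) ^ r \<ge> 3 ^ 1"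
    using assms(1) by (intro power_increasing) auto
  then have r: "(3::real) ^ r \<ge> 3"
    by simp
  have "n mod 3 = 0 \<or> n mod 3 = 1 \<or> n mod 3 = 2"
    by presburger
  then consider "n mod 3 = 0" | "n mod 3 = 1" | "n mod 3 = 2"
    by blast
  then show ?thesis
  proof cases
    case 1
    interpret two_residues r p n 1 5 "n div 3 - 1"
      using assms 1 by unfold_locales
        (auto simp: m_of_def x_res_def y_res_def delta_def excluded_class_def)
    have "real (g_P r p (2 * n)) = real (card (admissible r p 1 5 (n div 3 - 1)))"
      using double_g_P_admissible(1)[of r p n] assms(2,5) 1 by simp
    \<comment> \<open>Now \<open>m + 1 = n / 3\<close> and \<open>kappa_P\<close> is twice
      \<open>A_P\<close>, so the main term comes out without a correction.\<close>
    moreover have "real_of_int (n div 3) = real_of_int n / 3"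
      using 1 by (simp add: real_of_int_div dvd_eq_mod_eq_0)
    ultimately show ?thesis
      using card_admissible_eq_B_P abs_B_P_less[OF assms(1)] 1
      by (simp add: E_P_def kappa_P_def M_mod_def delta_def)
  next
    case 2
    have six_m: "6 * ((n - 1) div 3) = 2 * n - 2"
      using 2 by presburger
    interpret two_residues r p n 1 1 "(n - 1) div 3"
      using assms 2 six_m by unfold_locales
        (auto simp: m_of_def x_res_def y_res_def delta_def excluded_class_def)
    have "2 * int (g_P r p (2 * n))
        = int (card (admissible r p 1 1 ((n - 1) div 3))) + D_P r p n"
      using double_g_P_admissible(2)[of r p n] assms(2,5) 2 by blast
    then have "2 * real (g_P r p (2 * n))
        = real (card (admissible r p 1 1 ((n - 1) div 3))) + real_of_int (D_P r p n)"
      by linarith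
    \<comment> \<open>The surplus \<open>2 / 3\<close> over \<open>n / 3\<close>, halved, becomes
      the correction \<open>\<rho> / 3\<close>.\<close>
    moreover have "real_of_int ((n - 1) div 3) + 1 = (real_of_int n + 2) / 3"
      using arg_cong[OF six_m, of real_of_int] by simp
    ultimately have g_eq: "2 * real (g_P r p (2 * n))
        = B_P r p n + (real_of_int n + 2) / 3 * \<rho> + real_of_int (D_P r p n)"
      using card_admissible_eq_B_P by (simp add: \<rho>_def)
    have E: "E_P r p n = (B_P r p n + real_of_int (D_P r p n)) / 2 + \<rho> / 3"
      using 2 by (simp add: E_P_def delta_def \<rho>_def)
    have main: "real_of_int n / real_of_int (M_mod r p) * real_of_int (kappa_P r p n)
        = real_of_int n * \<rho> / 6"
      using 2 by (simp add: kappa_P_def M_mod_def delta_def \<rho>_def)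
    have "real (g_P r p (2 * n))
        = real_of_int n / real_of_int (M_mod r p) * real_of_int (kappa_P r p n) + E_P r p n"
      unfolding main using g_eq E by (simp add: field_simps)
    moreover have "\<bar>E_P r p n\<bar> < 3 ^ r - 1"
      using E \<rho>_bounds D r abs_B_P_less[OF assms(1)]
      by (simp add: abs_less_iff field_simps)
    ultimately show ?thesis
      by blast
  next
    case 3
    have six_m: "6 * ((n - 5) div 3) = 2 * n - 10"
      using 3 by presburger
    \<comment> \<open>The value -1 is attained at \<open>n = 2\<close>, where the range of
      \<open>z\<close> is empty.\<close>
    have m_ge: "(n - 5) div 3 \<ge> -1"
      using 3 assms(5) by presburger
    interpret two_residues r p n 5 5 "(n - 5) div 3"
      using assms 3 six_m m_ge by unfold_locales
        (auto simp: m_of_def x_res_def y_res_def delta_def excluded_class_def)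
    have "2 * int (g_P r p (2 * n))
        = int (card (admissible r p 5 5 ((n - 5) div 3))) + D_P r p n"
      using double_g_P_admissible(3)[of r p n] assms(2,5) 3 by blast
    then have "2 * real (g_P r p (2 * n))
        = real (card (admissible r p 5 5 ((n - 5) div 3))) + real_of_int (D_P r p n)"
      by linarith
    \<comment> \<open>This time \<open>m + 1\<close> falls short of \<open>n / 3\<close> by
      \<open>2 / 3\<close>, so the correction is negative.\<close>
    moreover have "real_of_int ((n - 5) div 3) + 1 = (real_of_int n - 2) / 3"
      using arg_cong[OF six_m, of real_of_int] by simp
    ultimately have g_eq: "2 * real (g_P r p (2 * n))
        = B_P r p n + (real_of_int n - 2) / 3 * \<rho> + real_of_int (D_P r p n)"
      using card_admissible_eq_B_P by (simp add: \<rho>_def)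
    have E: "E_P r p n = (B_P r p n + real_of_int (D_P r p n)) / 2 - \<rho> / 3"
      using 3 by (simp add: E_P_def delta_def \<rho>_def)
    have main: "real_of_int n / real_of_int (M_mod r p) * real_of_int (kappa_P r p n)
        = real_of_int n * \<rho> / 6"
      using 3 by (simp add: kappa_P_def M_mod_def delta_def \<rho>_def)
    have "real (g_P r p (2 * n))
        = real_of_int n / real_of_int (M_mod r p) * real_of_int (kappa_P r p n) + E_P r p n"
      unfolding main using g_eq E by (simp add: field_simps)
    moreover have "\<bar>E_P r p n\<bar> < 3 ^ r - 1"
      using E \<rho>_bounds D r abs_B_P_less[OF assms(1)]
      by (simp add: abs_less_iff field_simps)
    ultimately show ?thesis
      by blast
  qed
qed

end
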